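(* There is no universal constant $q>0$ such that, for every $n$, every weak $\mathbb T_q$-representation of $U_{2,n}$ is Lorentzian.
   Context: For $q>0$, a weak $\mathbb T_q$-representation of the rank-$2$ uniform matroid $U_{2,n}$ ($n\ge 2$) is a family of positive reals $(\rho_{ij})_{1\le i<j\le n}$ such that for all $1\le i<j<k<\ell\le n$ the three numbers $(\rho_{ij}\rho_{k\ell})^{1/q}$, $(\rho_{ik}\rho_{j\ell})^{1/q}$, $(\rho_{i\ell}\rho_{jk})^{1/q}$ are the side lengths of a (possibly degenerate) Euclidean triangle (each is at most the sum of the other two). It is called Lorentzian if the quadratic form $\sum_{i<j}\rho_{ij}x_ix_j$ is Lorentzian. A quadratic form with nonnegative coefficients in $x_1,\dots,x_n$ is Lorentzian if it is a limit of quadratic forms with nonnegative coefficients whose Hessians have exactly one positive and $n-1$ negative eigenvalues (equivalently, its Hessian has at most one positive eigenvalue). *)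

theory Defs
  imports "HOL-Analysis.Derivative" "Jordan_Normal_Form.Char_Poly"
begin

text \<open>
  The index set \<open>{1, \<dots>, n}\<close> is rendered as \<open>{0, \<dots>, n - 1}\<close>. A quadratic form in \<open>n\<close> variables
  is given by its coefficients \<open>c i j\<close> with \<open>i \<le> j < n\<close>, where \<open>c i j\<close> is the coefficient of the
  monomial \<open>x i * x j\<close>; all other values of \<open>c\<close> are irrelevant.
\<close>

definition quad_form :: "nat \<Rightarrow> (nat \<Rightarrow> nat \<Rightarrow> real) \<Rightarrow> (nat \<Rightarrow> real) \<Rightarrow> real" where
  "quad_form n c x = (\<Sum>j<n. \<Sum>i\<le>j. c i j * x i * x j)"

definition nonneg_coeffs :: "nat \<Rightarrow> (nat \<Rightarrow> nat \<Rightarrow> real) \<Rightarrow> bool" where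
  "nonneg_coeffs n c \<longleftrightarrow> (\<forall>i j. i \<le> j \<and> j < n \<longrightarrow> 0 \<le> c i j)"

definition partial_deriv :: "nat \<Rightarrow> ((nat \<Rightarrow> real) \<Rightarrow> real) \<Rightarrow> (nat \<Rightarrow> real) \<Rightarrow> real" where
  "partial_deriv i f x = deriv (\<lambda>t. f (x(i := t))) (x i)"

definition hessian :: "nat \<Rightarrow> ((nat \<Rightarrow> real) \<Rightarrow> real) \<Rightarrow> (nat \<Rightarrow> real) \<Rightarrow> real mat" where
  "hessian n f x = mat n n (\<lambda>(i, j). partial_deriv i (partial_deriv j f) x)"

lemma has_field_derivative_quad_form:
  assumes "k < n"
  shows "((\<lambda>t. quad_form n c (x(k := t))) has_field_derivative
           (\<Sum>j<n. (if j < k then c j k else if j = k then 2 * c k k else c k j) * x j)) (at (x k))"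
proof -
  have "((\<lambda>t. quad_form n c (x(k := t))) has_field_derivative
          (\<Sum>j<n. \<Sum>i\<le>j. c i j * (if i = k then 1 else 0) * x j
                         + c i j * x i * (if j = k then 1 else 0))) (at (x k))"
    unfolding quad_form_def
    by (intro DERIV_sum) (auto intro!: derivative_eq_intros)
  also have "(\<Sum>j<n. \<Sum>i\<le>j. c i j * (if i = k then 1 else 0) * x j
                         + c i j * x i * (if j = k then 1 else 0))
      = (\<Sum>j<n. (\<Sum>i\<le>j. if i = k then c i j * x j else 0))
        + (\<Sum>j<n. if j = k then (\<Sum>i\<le>j. c i j * x i) else 0)"
    unfolding sum.distrib[symmetric]
    by (intro sum.cong refl)
       (auto simp: sum.distrib if_distrib[of "\<lambda>u. _ * u"] if_distrib[of "\<lambda>u. u * _"] cong: if_cong)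
  also have "(\<Sum>j<n. if j = k then (\<Sum>i\<le>j. c i j * x i) else 0) = (\<Sum>i\<le>k. c i k * x i)"
    using assms by simp
  also have "\<dots> = (\<Sum>i<n. if i \<le> k then c i k * x i else 0)"
    using assms by (subst sum.inter_filter[symmetric]) (auto intro!: sum.cong)
  also have "(\<Sum>j<n. (\<Sum>i\<le>j. if i = k then c i j * x j else 0))
      = (\<Sum>j<n. if k \<le> j then c k j * x j else 0)"
    by (intro sum.cong refl) auto
  finally show ?thesis
    unfolding sum.distrib[symmetric]
    by (rule back_subst[where P = "\<lambda>D. (_ has_field_derivative D) _"])
       (intro sum.cong refl, auto)
qed

text \<open>The Hessian of a quadratic form does not depend on the point of evaluation.\<close>

lemma hessian_quad_form:
  "hessian n (quad_form n c) x =
     mat n n (\<lambda>(i, j). if i < j then c i j else if i = j then 2 * c i i else c j i)"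
  (is "_ = ?H")
proof (rule eq_matI)
  fix i j assume "i < dim_row ?H" "j < dim_col ?H"
  then have ij: "i < n" "j < n" by auto
  define h where "h = (\<lambda>l. if l < j then c l j else if l = j then 2 * c j j else c j l)"
  have pd: "partial_deriv j (quad_form n c) = (\<lambda>y. \<Sum>l<n. h l * y l)"
    unfolding partial_deriv_def h_def
    by (intro ext DERIV_imp_deriv has_field_derivative_quad_form ij)
  have "((\<lambda>t. \<Sum>l<n. h l * (x(i := t)) l) has_field_derivative
           (\<Sum>l<n. if l = i then h l else 0)) (at (x i))"
    by (intro DERIV_sum) (auto intro!: derivative_eq_intros)
  then have "partial_deriv i (partial_deriv j (quad_form n c)) x = h i"
    unfolding pd partial_deriv_def[of i] using ij by (auto dest: DERIV_imp_deriv)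
  then show "hessian n (quad_form n c) x $$ (i, j) = ?H $$ (i, j)"
    using ij by (simp add: hessian_def h_def)
qed (simp_all add: hessian_def)

text \<open>
  Eigenvalues are counted with algebraic multiplicity. Hessians of quadratic forms are real
  symmetric, so no eigenvalue is missed by taking real roots only.
\<close>

definition num_pos_eigenvalues :: "real mat \<Rightarrow> nat" where
  "num_pos_eigenvalues A = size {#a \<in># proots (char_poly A). 0 < a#}"

definition num_neg_eigenvalues :: "real mat \<Rightarrow> nat" where
  "num_neg_eigenvalues A = size {#a \<in># proots (char_poly A). a < 0#}"

definition strictly_lorentzian :: "nat \<Rightarrow> (nat \<Rightarrow> nat \<Rightarrow> real) \<Rightarrow> bool" where
  "strictly_lorentzian n c \<longleftrightarrow>
     nonneg_coeffs n c \<and>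
     num_pos_eigenvalues (hessian n (quad_form n c) (\<lambda>_. 0)) = 1 \<and>
     num_neg_eigenvalues (hessian n (quad_form n c) (\<lambda>_. 0)) = n - 1"

text \<open>
  Limits are taken in the finite-dimensional space of quadratic forms in \<open>n\<close> variables, that is,
  coefficientwise. The approximating forms may contain square terms \<open>x i * x i\<close>.
\<close>

definition lorentzian :: "nat \<Rightarrow> (nat \<Rightarrow> nat \<Rightarrow> real) \<Rightarrow> bool" where
  "lorentzian n c \<longleftrightarrow>
     nonneg_coeffs n c \<and>
     (\<exists>C :: nat \<Rightarrow> nat \<Rightarrow> nat \<Rightarrow> real.
        (\<forall>m. strictly_lorentzian n (C m)) \<and>
        (\<forall>i j. i \<le> j \<and> j < n \<longrightarrow> (\<lambda>m. C m i j) \<longlonglongrightarrow> c i j))"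

definition triangle_sides :: "real \<Rightarrow> real \<Rightarrow> real \<Rightarrow> bool" where
  "triangle_sides a b c \<longleftrightarrow> a \<le> b + c \<and> b \<le> a + c \<and> c \<le> a + b"

text \<open>Only the values \<open>\<rho> i j\<close> with \<open>i < j < n\<close> are relevant.\<close>

definition weak_Tq_representation :: "real \<Rightarrow> nat \<Rightarrow> (nat \<Rightarrow> nat \<Rightarrow> real) \<Rightarrow> bool" where
  "weak_Tq_representation q n \<rho> \<longleftrightarrow>
     (\<forall>i j. i < j \<and> j < n \<longrightarrow> 0 < \<rho> i j) \<and>
     (\<forall>i j k l. i < j \<and> j < k \<and> k < l \<and> l < n \<longrightarrow>
        triangle_sides ((\<rho> i j * \<rho> k l) powr (1 / q))
                       ((\<rho> i k * \<rho> j l) powr (1 / q))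
                       ((\<rho> i l * \<rho> j k) powr (1 / q)))"

definition lorentzian_representation :: "nat \<Rightarrow> (nat \<Rightarrow> nat \<Rightarrow> real) \<Rightarrow> bool" where
  "lorentzian_representation n \<rho> \<longleftrightarrow> lorentzian n (\<lambda>i j. if i < j then \<rho> i j else 0)"

end

theory Submission
  imports Defs "Jordan_Normal_Form.Schur_Decomposition"
begin

text \<open>
  Fix \<open>q > 0\<close> and put \<open>c = 2 powr (q / 2) > 1\<close>. If all \<open>\<rho> i j\<close> lie between \<open>1\<close> and \<open>c\<close>, then
  all the numbers \<open>(\<rho> i j * \<rho> k l) powr (1 / q)\<close> lie between \<open>1\<close> and \<open>2\<close>, and any three
  numbers in that range are the sides of a triangle. So \<^emph>\<open>every\<close> such \<open>\<rho>\<close> is a weak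
  \<open>T\<^sub>q\<close>-representation (\<open>weak_Tq_representation_if_bounded\<close>).

  Split \<open>2 * m\<close> indices into two blocks of size \<open>m\<close>, with \<open>\<rho> i j = c\<close> inside a block and
  \<open>\<rho> i j = 1\<close> across the blocks. On the indicator vectors \<open>x\<close>, \<open>y\<close> of the blocks the Hessian
  \<open>H\<close> takes the values \<open>x \<bullet> H x = y \<bullet> H y = c * m * (m - 1)\<close> and \<open>x \<bullet> H y = m * m\<close>. As \<open>c > 1\<close>,
  the former exceed the latter once \<open>m\<close> is large, so \<open>H\<close> is positive definite on the plane
  spanned by \<open>x\<close> and \<open>y\<close>. A Lorentzian form does not allow this: its Hessian satisfies the
  reverse Cauchy-Schwarz inequality \<open>(x \<bullet> H x) * (y \<bullet> H y) \<le> (x \<bullet> H y)\<^sup>2\<close> whenever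
  \<open>x \<bullet> H x > 0\<close> (\<open>lorentzian_reverse_Cauchy_Schwarz\<close>).

  That inequality is stable under limits, so it suffices to have it for symmetric matrices all of
  whose eigenvalues are real and exactly one of them positive. Such a form is a sum of squares
  of linear forms weighted by the eigenvalues (\<open>real_symmetric_sum_of_squares\<close>, the spectral
  theorem). On the kernel of the linear form that belongs to the positive eigenvalue it is at
  most \<open>0\<close>, and this kernel contains a nontrivial linear combination of any two vectors.
\<close>

section \<open>Diagonalisation of real symmetric matrices\<close>

(* These clash with the scalar product and the indexing of vectors of variable dimension. *)
no_notation inner (infix "\<bullet>" 70)
no_notation vec_nth (infixl "$" 90)

lemma linear_factors_if_size_proots_eq_degree:
  fixes p :: "'a::field poly"
  assumes "monic p" "size (proots p) = degree p"
  shows "\<exists>es. mset es = proots p \<and> p = (\<Prod>e\<leftarrow>es. [:-e, 1:])"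
  using assms
proof (induction "degree p" arbitrary: p)
  case 0
  then have "p = 1" by (simp add: monic_degree_0)
  then show ?case by (intro exI[of _ "[]"]) simp
next
  case (Suc d)
  then have p0: "p \<noteq> 0" by auto
  have "proots p \<noteq> {#}" using Suc by auto
  then obtain a where "a \<in># proots p" by auto
  then have "poly p a = 0" using p0 by auto
  then obtain r where r: "p = [:-a, 1:] * r" using poly_eq_0_iff_dvd by (metis dvdE)
  then have r0: "r \<noteq> 0" using p0 by auto
  have pr: "proots p = {#a#} + proots r"
    unfolding r using r0 by (subst proots_mult) auto
  have deg: "degree p = Suc (degree r)"
    unfolding r using r0 by (subst degree_mult_eq) auto
  have "monic r" using Suc.prems(1) unfolding r lead_coeff_mult by simp
  then obtain es where "mset es = proots r" "r = (\<Prod>e\<leftarrow>es. [:-e, 1:])"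
    using Suc.hyps(1)[of r] Suc.hyps(2) Suc.prems pr deg by auto
  then show ?case using pr r by (intro exI[of _ "a # es"]) auto
qed

lemma orthogonal_mat_with_first_col:
  fixes v :: "real vec"
  assumes v: "v \<in> carrier_vec n" and v0: "v \<noteq> 0\<^sub>v n"
  obtains W c where "W \<in> carrier_mat n n" "transpose_mat W * W = 1\<^sub>m n" "col W 0 = c \<cdot>\<^sub>v v"
proof -
  interpret cof_vec_space n "TYPE(real)" .
  define b where "b = basis_completion v"
  define ws where "ws = gram_schmidt n b"
  note bc = basis_completion[OF v v0, folded b_def]
  have n: "n > 0" using v v0 by (cases n) auto
  obtain vs where bv: "b = v # vs" using bc(6,7) n by (cases b) auto
  have ws: "set ws \<subseteq> carrier_vec n" "corthogonal ws" "length ws = n"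
    using gram_schmidt_result[OF bc(2,4,5) refl, folded ws_def] bc(6) by auto
  have hd: "hd ws = v" using gram_schmidt_hd[OF v, of vs, folded bv] unfolding ws_def .
  define us where "us = map (\<lambda>w. (1 / sqrt (w \<bullet> w)) \<cdot>\<^sub>v w) ws"
  define W where "W = mat_of_cols n us"
  have len: "length us = n" using ws(3) by (simp add: us_def)
  have wsi: "ws ! i \<in> carrier_vec n" if "i < n" for i using ws that by auto
  have usi: "us ! i = (1 / sqrt (ws ! i \<bullet> ws ! i)) \<cdot>\<^sub>v (ws ! i)" if "i < n" for i
    using that ws(3) by (simp add: us_def)
  have W: "W \<in> carrier_mat n n" unfolding W_def using len by auto
  have colW: "col W i = us ! i" if "i < n" for i
    unfolding W_def using that len usi[OF that] wsi[OF that] by (intro col_mat_of_cols) auto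
  have orth: "ws ! i \<bullet> ws ! j = 0 \<longleftrightarrow> i \<noteq> j" if "i < n" "j < n" for i j
    using corthogonalD[OF ws(2), of i j] that ws(3) by simp
  have pos: "ws ! i \<bullet> ws ! i > 0" if "i < n" for i
    using orth[OF that that] conjugate_square_ge_0_vec[of "ws ! i"] by auto
  have "transpose_mat W * W = 1\<^sub>m n"
  proof (rule eq_matI)
    fix i j assume "i < dim_row (1\<^sub>m n :: real mat)" "j < dim_col (1\<^sub>m n :: real mat)"
    then have ij: "i < n" "j < n" by auto
    have "(transpose_mat W * W) $$ (i, j) = us ! i \<bullet> us ! j"
      using W ij colW by simp
    also have "\<dots> = (ws ! i \<bullet> ws ! j) / (sqrt (ws ! i \<bullet> ws ! i) * sqrt (ws ! j \<bullet> ws ! j))"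
      unfolding usi[OF ij(1)] usi[OF ij(2)] using wsi[OF ij(1)] wsi[OF ij(2)] by simp
    also have "\<dots> = 1\<^sub>m n $$ (i, j)"
      using ij orth[OF ij] pos[OF ij(1)] by auto
    finally show "(transpose_mat W * W) $$ (i, j) = 1\<^sub>m n $$ (i, j)" .
  qed (use W in auto)
  moreover have "ws ! 0 = v" using hd ws(3) n by (metis hd_conv_nth length_0_conv less_irrefl)
  then have "col W 0 = (1 / sqrt (v \<bullet> v)) \<cdot>\<^sub>v v"
    using colW[OF n] usi[OF n] by simp
  ultimately show ?thesis using that W by blast
qed

text \<open>
  The spectral theorem in the form needed below: the quadratic form of \<open>A\<close> is a combination of
  squares of linear forms, the weights being the eigenvalues with multiplicity. The proof deflates
  \<open>A\<close> by one eigenvector at a time. That the eigenvalues are real is assumed, not proved.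
\<close>

lemma real_symmetric_sum_of_squares:
  fixes A :: "real mat"
  assumes "A \<in> carrier_mat n n" "transpose_mat A = A"
    and "char_poly A = (\<Prod>e\<leftarrow>es. [:-e, 1:])"
  shows "\<exists>L. (\<forall>i<length es. L i \<in> carrier_vec n) \<and>
    (\<forall>x\<in>carrier_vec n. x \<bullet> (A *\<^sub>v x) = (\<Sum>i<length es. es ! i * (L i \<bullet> x)\<^sup>2))"
  using assms
proof (induction es arbitrary: n A)
  case Nil
  then have "n = 0" using degree_monic_char_poly[of A n] by simp
  then show ?case using Nil by (auto simp: scalar_prod_def)
next
  case (Cons e es)
  note A = \<open>A \<in> carrier_mat n n\<close> and sym = \<open>transpose_mat A = A\<close>
  have ev: "eigenvalue A e"
    unfolding eigenvalue_root_char_poly[OF A] Cons.prems(3) by simp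
  then obtain v where v: "v \<in> carrier_vec n" "v \<noteq> 0\<^sub>v n" "A *\<^sub>v v = e \<cdot>\<^sub>v v"
    unfolding eigenvalue_def eigenvector_def using A by auto
  obtain W c where W: "W \<in> carrier_mat n n" and WW: "transpose_mat W * W = 1\<^sub>m n"
    and col0: "col W 0 = c \<cdot>\<^sub>v v"
    using orthogonal_mat_with_first_col[OF v(1,2)] .
  define T where "T = transpose_mat W"
  have T: "T \<in> carrier_mat n n" using W by (simp add: T_def)
  have TW: "T * W = 1\<^sub>m n" using WW by (simp add: T_def)
  have WT: "W * T = 1\<^sub>m n" using mat_mult_left_right_inverse[OF T W TW] .
  obtain m where n: "n = Suc m" using v by (cases n) auto
  define B where "B = T * (A * W)"
  have B: "B \<in> carrier_mat n n" using T A W by (simp add: B_def)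
  have "similar_mat B A"
    unfolding similar_mat_def
    by (rule exI[of _ T], rule exI[of _ W], rule similar_mat_witI[of T W n])
      (use T A W B TW WT in \<open>auto simp: B_def\<close>)
  then have cpB: "char_poly B = char_poly A" by (rule char_poly_similar)
  have symB: "transpose_mat B = B"
  proof -
    have "transpose_mat B = transpose_mat (A * W) * W"
      unfolding B_def T_def using T A W by (subst transpose_mult[of _ n n _ n]) (auto simp: T_def)
    also have "transpose_mat (A * W) = T * A"
      using A W sym by (subst transpose_mult[of _ n n _ n]) (auto simp: T_def)
    also have "T * A * W = B" unfolding B_def using T A W by (intro assoc_mult_mat)
    finally show ?thesis .
  qed
  \<comment> \<open>The first column of \<open>W\<close> is an eigenvector, so the first column of \<open>B\<close>, hence by symmetry
    its first row, vanishes off the diagonal.\<close>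
  have colB: "B $$ (i, 0) = (if i = 0 then e else 0)" if i: "i < n" for i
  proof -
    have "B $$ (i, 0) = row T i \<bullet> col (A * W) 0"
      using i n T A W by (simp add: B_def)
    also have "col (A * W) 0 = A *\<^sub>v col W 0"
      using n by (intro col_mult2[OF A W]) simp
    also have "A *\<^sub>v col W 0 = e \<cdot>\<^sub>v col W 0"
      unfolding col0 using A v by (simp add: mult_mat_vec smult_smult_assoc mult.commute)
    also have "row T i \<bullet> (e \<cdot>\<^sub>v col W 0) = e * (T * W) $$ (i, 0)"
      using i n T W by simp
    finally show ?thesis unfolding TW using i n by simp
  qed
  have rowB: "B $$ (0, i) = (if i = 0 then e else 0)" if i: "i < n" for i
    using colB[OF i] symB B i n by (metis carrier_matD index_transpose_mat(1) zero_less_Suc)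
  define A3 where "A3 = mat m m (\<lambda>(i, j). B $$ (Suc i, Suc j))"
  have A3: "A3 \<in> carrier_mat m m" by (simp add: A3_def)
  have sym3: "transpose_mat A3 = A3"
  proof (rule eq_matI)
    fix i j assume ij: "i < dim_row A3" "j < dim_col A3"
    have "B $$ (Suc j, Suc i) = transpose_mat B $$ (Suc i, Suc j)"
      using ij B n A3 by simp
    then show "transpose_mat A3 $$ (i, j) = A3 $$ (i, j)"
      using ij symB by (simp add: A3_def)
  qed (use A3 in auto)
  let ?E = "mat 1 1 (\<lambda>_. e)"
  have Bblock: "B = four_block_mat ?E (0\<^sub>m 1 m) (0\<^sub>m m 1) A3"
  proof (rule eq_matI)
    fix i j assume "i < dim_row (four_block_mat ?E (0\<^sub>m 1 m) (0\<^sub>m m 1) A3)"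
      "j < dim_col (four_block_mat ?E (0\<^sub>m 1 m) (0\<^sub>m m 1) A3)"
    then have "i < n" "j < n" using A3 n by auto
    then show "B $$ (i, j) = four_block_mat ?E (0\<^sub>m 1 m) (0\<^sub>m m 1) A3 $$ (i, j)"
      using n colB rowB by (cases i; cases j) (auto simp: A3_def)
  qed (use B A3 n in auto)
  have "char_poly B = char_poly ?E * char_poly A3"
    unfolding Bblock by (rule char_poly_four_block_zeros_col) (use A3 in auto)
  also have "char_poly ?E = [:-e, 1:]"
    by (simp add: char_poly_defs det_def sign_def)
  finally have "[:-e, 1:] * char_poly A3 = [:-e, 1:] * (\<Prod>e\<leftarrow>es. [:-e, 1:])"
    using cpB Cons.prems(3) by simp
  then have cp3: "char_poly A3 = (\<Prod>e\<leftarrow>es. [:-e, 1:])"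
    by (metis mult_cancel_left pCons_eq_0_iff zero_neq_one)
  obtain L where L: "\<And>i. i < length es \<Longrightarrow> L i \<in> carrier_vec m"
    and Lsum: "\<And>x. x \<in> carrier_vec m \<Longrightarrow>
      x \<bullet> (A3 *\<^sub>v x) = (\<Sum>i<length es. es ! i * (L i \<bullet> x)\<^sup>2)"
    using Cons.IH[OF A3 sym3 cp3] by blast
  \<comment> \<open>The linear forms of the smaller block, pulled back to the original coordinates along \<open>W\<close>.\<close>
  define M where "M i = (case i of 0 \<Rightarrow> col W 0 | Suc i \<Rightarrow> W *\<^sub>v (0\<^sub>v 1 @\<^sub>v L i))" for i
  show ?case
  proof (intro exI[of _ M] conjI allI ballI impI)
    fix i assume "i < length (e # es)"
    then show "M i \<in> carrier_vec n"
      using W by (cases i) (auto simp: M_def intro!: carrier_vecI)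
  next
    fix x :: "real vec" assume x: "x \<in> carrier_vec n"
    define z where "z = T *\<^sub>v x"
    have z: "z \<in> carrier_vec n" using T x by (simp add: z_def)
    define z1 where "z1 = vec 1 (\<lambda>_. z $ 0)"
    define z2 where "z2 = vec m (\<lambda>i. z $ Suc i)"
    have zz: "z = z1 @\<^sub>v z2" 
      using z n by (intro eq_vecI) (auto simp: z1_def z2_def less_Suc_eq_0_disj)
    have z12: "z1 \<in> carrier_vec 1" "z2 \<in> carrier_vec m" by (auto simp: z1_def z2_def)
    have xz: "x = W *\<^sub>v z"
      unfolding z_def using W T x WT by (simp flip: assoc_mult_mat_vec)
    have dual: "(W *\<^sub>v y) \<bullet> x = y \<bullet> z" if "y \<in> carrier_vec n" for y
      using transpose_vec_mult_scalar[OF T x that] by (simp add: z_def T_def)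
    have "x \<bullet> (A *\<^sub>v x) = z \<bullet> (T *\<^sub>v (A *\<^sub>v x))"
    proof -
      have "x \<bullet> (A *\<^sub>v x) = (W *\<^sub>v z) \<bullet> (A *\<^sub>v x)" using xz by simp
      also have "\<dots> = z \<bullet> (T *\<^sub>v (A *\<^sub>v x))"
        using transpose_vec_mult_scalar[OF T _ z, of "A *\<^sub>v x"] A x by (simp add: T_def)
      finally show ?thesis .
    qed
    also have "T *\<^sub>v (A *\<^sub>v x) = B *\<^sub>v z"
      using T A W z by (subst xz) (simp add: B_def assoc_mult_mat_vec[of _ n n _ n])
    also have "z \<bullet> (B *\<^sub>v z) = z1 \<bullet> (?E *\<^sub>v z1) + z2 \<bullet> (A3 *\<^sub>v z2)"
    proof -
      have "B *\<^sub>v z = (?E *\<^sub>v z1) @\<^sub>v (A3 *\<^sub>v z2)"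
        unfolding zz Bblock using A3 z12 by (intro mult_mat_vec_split) auto
      then show ?thesis
        unfolding zz by (simp only:, intro scalar_prod_append[OF z12])
          (use A3 in \<open>auto intro!: carrier_vecI\<close>)
    qed
    also have "z1 \<bullet> (?E *\<^sub>v z1) = e * (z $ 0)\<^sup>2"
      by (simp add: z1_def scalar_prod_def power2_eq_square)
    also have "z $ 0 = M 0 \<bullet> x"
      using n W x by (simp add: M_def z_def T_def)
    also have "z2 \<bullet> (A3 *\<^sub>v z2) = (\<Sum>i<length es. es ! i * (M (Suc i) \<bullet> x)\<^sup>2)"
    proof -
      have "M (Suc i) \<bullet> x = L i \<bullet> z2" if "i < length es" for i
      proof -
        have "M (Suc i) \<bullet> x = (0\<^sub>v 1 @\<^sub>v L i) \<bullet> z"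
          unfolding M_def using L[OF that] n by (simp, intro dual carrier_vecI) simp
        also have "\<dots> = L i \<bullet> z2"
          unfolding zz using L[OF that] z12 by (subst scalar_prod_append[of _ 1 _ m]) auto
        finally show ?thesis .
      qed
      then show ?thesis using Lsum[OF z12(2)] by simp
    qed
    finally show "x \<bullet> (A *\<^sub>v x) = (\<Sum>i<length (e # es). (e # es) ! i * (M i \<bullet> x)\<^sup>2)"
      by (simp add: sum.lessThan_Suc_shift del: sum.lessThan_Suc)
  qed
qed

section \<open>The reverse Cauchy-Schwarz inequality\<close>

lemma symmetric_bilinear_commute:
  fixes A :: "'a::comm_semiring_0 mat"
  assumes "A \<in> carrier_mat n n" "transpose_mat A = A" "x \<in> carrier_vec n" "y \<in> carrier_vec n"
  shows "y \<bullet> (A *\<^sub>v x) = x \<bullet> (A *\<^sub>v y)"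
  using transpose_vec_mult_scalar[OF assms(1,3,4)] assms
  by (simp add: comm_scalar_prod[of _ n])

lemma reverse_Cauchy_Schwarz:
  fixes A :: "real mat"
  assumes A: "A \<in> carrier_mat n n" and sym: "transpose_mat A = A"
    and all: "size (proots (char_poly A)) = n"
    and one: "num_pos_eigenvalues A = 1"
    and x: "x \<in> carrier_vec n" and y: "y \<in> carrier_vec n"
    and pos: "x \<bullet> (A *\<^sub>v x) > 0"
  shows "(x \<bullet> (A *\<^sub>v x)) * (y \<bullet> (A *\<^sub>v y)) \<le> (x \<bullet> (A *\<^sub>v y))\<^sup>2"
proof -
  obtain es where es: "mset es = proots (char_poly A)"
    and cp: "char_poly A = (\<Prod>e\<leftarrow>es. [:-e, 1:])"
    using linear_factors_if_size_proots_eq_degree[of "char_poly A"] degree_monic_char_poly[OF A] all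
    by auto
  obtain L where L: "\<And>i. i < length es \<Longrightarrow> L i \<in> carrier_vec n"
    and Lsum: "\<And>x. x \<in> carrier_vec n \<Longrightarrow>
      x \<bullet> (A *\<^sub>v x) = (\<Sum>i<length es. es ! i * (L i \<bullet> x)\<^sup>2)"
    using real_symmetric_sum_of_squares[OF A sym cp] by blast
  have "size (filter_mset (\<lambda>a. 0 < a) (mset es)) = 1"
    using one unfolding num_pos_eigenvalues_def es .
  then have "card {i. i < length es \<and> 0 < es ! i} = 1"
    by (simp flip: length_filter_conv_card mset_filter)
  then obtain k where "{i. i < length es \<and> 0 < es ! i} = {k}"
    using card_1_singletonE by blast
  then have k: "k < length es" and neg: "\<And>i. i < length es \<Longrightarrow> i \<noteq> k \<Longrightarrow> es ! i \<le> 0"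
    by (blast, metis (mono_tags, lifting) leI mem_Collect_eq singletonD)
  have nonpos: "z \<bullet> (A *\<^sub>v z) \<le> 0" if z: "z \<in> carrier_vec n" and "L k \<bullet> z = 0" for z
    unfolding Lsum[OF z]
  proof (rule sum_nonpos)
    fix i assume "i \<in> {..<length es}"
    then show "es ! i * (L i \<bullet> z)\<^sup>2 \<le> 0"
      using neg[of i] that(2) by (cases "i = k") (auto intro: mult_nonpos_nonneg)
  qed
  \<comment> \<open>The combination \<open>s x - t y\<close> lies in the kernel of the only linear form with positive weight.\<close>
  define s where "s = L k \<bullet> y"
  define t where "t = L k \<bullet> x"
  have "t \<noteq> 0" using nonpos[OF x] pos by (auto simp: t_def)
  define P where "P = x \<bullet> (A *\<^sub>v x)"
  define R where "R = x \<bullet> (A *\<^sub>v y)"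
  define N where "N = y \<bullet> (A *\<^sub>v y)"
  have R': "y \<bullet> (A *\<^sub>v x) = R"
    unfolding R_def by (rule symmetric_bilinear_commute[OF A sym x y])
  let ?z = "s \<cdot>\<^sub>v x - t \<cdot>\<^sub>v y"
  have "L k \<bullet> ?z = 0"
    using L[OF k] x y by (simp add: scalar_prod_minus_distrib[of _ n] s_def t_def)
  then have "?z \<bullet> (A *\<^sub>v ?z) \<le> 0" using x y by (intro nonpos) auto
  also have "?z \<bullet> (A *\<^sub>v ?z) = s\<^sup>2 * P - 2 * s * t * R + t\<^sup>2 * N"
    using A x y R'
    by (simp add: mult_minus_distrib_mat_vec[of _ n n] mult_mat_vec[of _ n n]
        minus_scalar_prod_distrib[of _ n] scalar_prod_minus_distrib[of _ n]
        P_def R_def N_def power2_eq_square algebra_simps)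
  finally have "P * (s\<^sup>2 * P - 2 * s * t * R + t\<^sup>2 * N) \<le> 0"
    using pos by (simp add: P_def mult_le_0_iff)
  moreover have "P * (s\<^sup>2 * P - 2 * s * t * R + t\<^sup>2 * N) = (s * P - t * R)\<^sup>2 + t\<^sup>2 * (P * N - R\<^sup>2)"
    by (simp add: power2_eq_square algebra_simps)
  ultimately have "t\<^sup>2 * (P * N - R\<^sup>2) \<le> 0"
    using zero_le_power2[of "s * P - t * R"] by linarith
  then have "P * N \<le> R\<^sup>2" using \<open>t \<noteq> 0\<close> by (simp add: mult_le_0_iff)
  then show ?thesis by (simp add: P_def N_def R_def)
qed

lemma strictly_lorentzian_reverse_Cauchy_Schwarz:
  assumes "strictly_lorentzian n c" "n \<ge> 1"
    and x: "x \<in> carrier_vec n" and y: "y \<in> carrier_vec n"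
  defines "H \<equiv> hessian n (quad_form n c) (\<lambda>_. 0)"
  assumes "x \<bullet> (H *\<^sub>v x) > 0"
  shows "(x \<bullet> (H *\<^sub>v x)) * (y \<bullet> (H *\<^sub>v y)) \<le> (x \<bullet> (H *\<^sub>v y))\<^sup>2"
proof (rule reverse_Cauchy_Schwarz)
  show H: "H \<in> carrier_mat n n" by (simp add: H_def hessian_def)
  show "transpose_mat H = H"
    by (rule eq_matI) (auto simp: H_def hessian_quad_form)
  show one: "num_pos_eigenvalues H = 1"
    using assms(1) by (simp add: strictly_lorentzian_def H_def)
  \<comment> \<open>One positive and \<open>n - 1\<close> negative eigenvalues exhaust the degree, so all roots are real.\<close>
  let ?r = "proots (char_poly H)"
  have "{#a \<in># ?r. 0 < a#} + {#a \<in># ?r. a < 0#} \<subseteq># ?r"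
    by (auto simp: subseteq_mset_def)
  then have "num_pos_eigenvalues H + num_neg_eigenvalues H \<le> size ?r"
    unfolding num_pos_eigenvalues_def num_neg_eigenvalues_def
    by (metis size_mset_mono size_union)
  then have "n \<le> size ?r"
    using assms(1,2) by (simp add: strictly_lorentzian_def H_def)
  moreover have "size ?r \<le> n"
    using size_proots_le[of "char_poly H"] degree_monic_char_poly[OF H] by simp
  ultimately show "size ?r = n" by simp
qed (use assms in auto)

lemma lorentzian_reverse_Cauchy_Schwarz:
  assumes lor: "lorentzian n c" and n: "n \<ge> 1"
    and x: "x \<in> carrier_vec n" and y: "y \<in> carrier_vec n"
  defines "H \<equiv> hessian n (quad_form n c) (\<lambda>_. 0)"
  assumes pos: "x \<bullet> (H *\<^sub>v x) > 0"
  shows "(x \<bullet> (H *\<^sub>v x)) * (y \<bullet> (H *\<^sub>v y)) \<le> (x \<bullet> (H *\<^sub>v y))\<^sup>2"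
proof -
  obtain C where C: "\<And>m. strictly_lorentzian n (C m)"
    and lim: "\<And>i j. i \<le> j \<Longrightarrow> j < n \<Longrightarrow> (\<lambda>m. C m i j) \<longlonglongrightarrow> c i j"
    using lor unfolding lorentzian_def by blast
  define K where "K m = hessian n (quad_form n (C m)) (\<lambda>_. 0)" for m
  have entry: "(\<lambda>m. K m $$ (i, j)) \<longlonglongrightarrow> H $$ (i, j)" if "i < n" "j < n" for i j
    using that lim by (auto simp: K_def H_def hessian_quad_form intro!: tendsto_intros)
  have form: "u \<bullet> (M *\<^sub>v v) = (\<Sum>i<n. u $ i * (\<Sum>j<n. M $$ (i, j) * v $ j))"
    if "u \<in> carrier_vec n" "v \<in> carrier_vec n" "M \<in> carrier_mat n n" for u v and M :: "real mat"
    using that by (auto simp: scalar_prod_def atLeast0LessThan intro!: sum.cong)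
  have tends: "(\<lambda>m. u \<bullet> (K m *\<^sub>v v)) \<longlonglongrightarrow> u \<bullet> (H *\<^sub>v v)"
    if uv: "u \<in> carrier_vec n" "v \<in> carrier_vec n" for u v
  proof -
    have "K m \<in> carrier_mat n n" "H \<in> carrier_mat n n" for m
      by (simp_all add: K_def H_def hessian_def)
    then show ?thesis
      using uv by (auto simp: form intro!: tendsto_intros entry)
  qed
  show ?thesis
  proof (rule tendsto_le[OF sequentially_bot])
    show "(\<lambda>m. (x \<bullet> (K m *\<^sub>v x)) * (y \<bullet> (K m *\<^sub>v y)))
            \<longlonglongrightarrow> (x \<bullet> (H *\<^sub>v x)) * (y \<bullet> (H *\<^sub>v y))"
      by (intro tendsto_intros tends x y)
    show "(\<lambda>m. (x \<bullet> (K m *\<^sub>v y))\<^sup>2) \<longlonglongrightarrow> (x \<bullet> (H *\<^sub>v y))\<^sup>2"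
      by (intro tendsto_intros tends x y)
    show "\<forall>\<^sub>F m in sequentially.
        (x \<bullet> (K m *\<^sub>v x)) * (y \<bullet> (K m *\<^sub>v y)) \<le> (x \<bullet> (K m *\<^sub>v y))\<^sup>2"
      using order_tendstoD(1)[OF tends[OF x x] pos]
      by eventually_elim
        (use strictly_lorentzian_reverse_Cauchy_Schwarz[OF C n x y] in \<open>simp add: K_def\<close>)
  qed
qed

section \<open>The two-block representation\<close>

lemma weak_Tq_representation_if_bounded:
  assumes q: "q > 0" and bd: "\<And>i j. i < j \<Longrightarrow> j < n \<Longrightarrow> 1 \<le> \<rho> i j \<and> \<rho> i j \<le> 2 powr (q / 2)"
  shows "weak_Tq_representation q n \<rho>"
proof -
  have bounds: "1 \<le> (\<rho> i j * \<rho> k l) powr (1 / q) \<and> (\<rho> i j * \<rho> k l) powr (1 / q) \<le> 2"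
    if "i < j" "j < n" "k < l" "l < n" for i j k l
  proof -
    have "1 * 1 \<le> \<rho> i j * \<rho> k l"
      using bd that by (intro mult_mono) (auto intro: order_trans[OF zero_le_one])
    moreover have "\<rho> i j * \<rho> k l \<le> 2 powr (q / 2) * 2 powr (q / 2)"
      using bd that by (intro mult_mono) (auto intro: order_trans[OF zero_le_one])
    then have "\<rho> i j * \<rho> k l \<le> 2 powr q" by (simp flip: powr_add)
    ultimately have "1 \<le> (\<rho> i j * \<rho> k l) powr (1 / q)"
      "(\<rho> i j * \<rho> k l) powr (1 / q) \<le> (2 powr q) powr (1 / q)"
      using q by (auto intro!: powr_mono2 ge_one_powr_ge_zero)
    moreover have "(2 powr q) powr (1 / q) = (2 :: real)"
      using q unfolding powr_powr by simp
    ultimately show ?thesis by simp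
  qed
  have tri: "triangle_sides a b c" if "1 \<le> a \<and> a \<le> 2" "1 \<le> b \<and> b \<le> 2" "1 \<le> c \<and> c \<le> 2" for a b c
    using that by (auto simp: triangle_sides_def)
  show ?thesis
    unfolding weak_Tq_representation_def
  proof (intro conjI allI impI)
    fix i j assume "i < j \<and> j < n"
    then show "0 < \<rho> i j" using bd[of i j] by linarith
  next
    fix i j k l assume "i < j \<and> j < k \<and> k < l \<and> l < n"
    then show "triangle_sides ((\<rho> i j * \<rho> k l) powr (1 / q))
        ((\<rho> i k * \<rho> j l) powr (1 / q)) ((\<rho> i l * \<rho> j k) powr (1 / q))"
      by (intro tri bounds) auto
  qed
qed

text \<open>
  The indices below \<open>m\<close> form one block, all others the second one: \<open>c\<close> is the value within a
  block, \<open>1\<close> the value across. The diagonal value \<open>c\<close> plays no role.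
\<close>

definition two_blocks :: "nat \<Rightarrow> real \<Rightarrow> nat \<Rightarrow> nat \<Rightarrow> real" where
  "two_blocks m c i j = (if i < m \<longleftrightarrow> j < m then c else 1)"

lemma two_blocks_not_lorentzian:
  assumes m: "m \<ge> 1" and c: "c * (real m - 1) > real m"
  shows "\<not> lorentzian_representation (2 * m) (two_blocks m c)"
proof
  assume "lorentzian_representation (2 * m) (two_blocks m c)"
  then have lor: "lorentzian (2 * m) (\<lambda>i j. if i < j then two_blocks m c i j else 0)"
    by (simp add: lorentzian_representation_def)
  let ?H = "hessian (2 * m) (quad_form (2 * m) (\<lambda>i j. if i < j then two_blocks m c i j else 0)) (\<lambda>_. 0)"
  define x :: "real vec" where "x = vec (2 * m) (\<lambda>i. if i < m then 1 else 0)"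
  define y :: "real vec" where "y = vec (2 * m) (\<lambda>i. if i < m then 0 else 1)"
  have xy: "x \<in> carrier_vec (2 * m)" "y \<in> carrier_vec (2 * m)" by (auto simp: x_def y_def)
  have split_add: "(\<Sum>j<m + k. f j) = (\<Sum>j<m. f j) + (\<Sum>j<k. f (m + j))" for f :: "nat \<Rightarrow> real" and k
    by (induction k) (auto simp: add.assoc)
  have split: "(\<Sum>j<2 * m. f j) = (\<Sum>j<m. f j) + (\<Sum>j<m. f (m + j))" for f :: "nat \<Rightarrow> real"
    using split_add[of f m] by (simp add: mult_2)
  have row: "(\<Sum>j<m. if i = j then 0 else c) = c * (real m - 1)" if "i < m" for i
    using that by (subst sum.remove[of _ i]) (auto simp: algebra_simps of_nat_diff)
  have H: "?H = mat (2 * m) (2 * m) (\<lambda>(i, j). if i = j then 0 else two_blocks m c i j)"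
    unfolding hessian_quad_form by (rule cong_mat) (auto simp: two_blocks_def)
  have Hx: "?H *\<^sub>v x = vec (2 * m) (\<lambda>i. if i < m then c * (real m - 1) else real m)"
  proof (rule eq_vecI)
    fix i assume "i < dim_vec (vec (2 * m) (\<lambda>i. if i < m then c * (real m - 1) else real m))"
    then have i: "i < 2 * m" by simp
    have "(?H *\<^sub>v x) $ i = (\<Sum>j<m. if i = j then 0 else two_blocks m c i j)"
      unfolding H using i by (simp add: scalar_prod_def atLeast0LessThan x_def split)
    also have "\<dots> = (if i < m then c * (real m - 1) else real m)"
    proof (cases "i < m")
      case True
      then have "(\<Sum>j<m. if i = j then 0 else two_blocks m c i j) = (\<Sum>j<m. if i = j then 0 else c)"
        by (intro sum.cong) (auto simp: two_blocks_def)
      then show ?thesis using row[OF True] True by simp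
    next
      case False
      then have "(\<Sum>j<m. if i = j then 0 else two_blocks m c i j) = (\<Sum>j<m. 1)"
        by (intro sum.cong) (auto simp: two_blocks_def)
      then show ?thesis using False by simp
    qed
    finally show "(?H *\<^sub>v x) $ i = vec (2 * m) (\<lambda>i. if i < m then c * (real m - 1) else real m) $ i"
      using i by simp
  qed (simp add: H)
  have Hy: "?H *\<^sub>v y = vec (2 * m) (\<lambda>i. if i < m then real m else c * (real m - 1))"
  proof (rule eq_vecI)
    fix i assume "i < dim_vec (vec (2 * m) (\<lambda>i. if i < m then real m else c * (real m - 1)))"
    then have i: "i < 2 * m" by simp
    have "(?H *\<^sub>v y) $ i = (\<Sum>j<m. if i = m + j then 0 else two_blocks m c i (m + j))"
      unfolding H using i by (simp add: scalar_prod_def atLeast0LessThan y_def split)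
    also have "\<dots> = (if i < m then real m else c * (real m - 1))"
    proof (cases "i < m")
      case True
      then have "(\<Sum>j<m. if i = m + j then 0 else two_blocks m c i (m + j)) = (\<Sum>j<m. 1)"
        by (intro sum.cong) (auto simp: two_blocks_def)
      then show ?thesis using True by simp
    next
      case False
      then obtain k where k: "i = m + k" by (metis le_Suc_ex not_less)
      then have "k < m" using i by simp
      have "(\<Sum>j<m. if i = m + j then 0 else two_blocks m c i (m + j)) = (\<Sum>j<m. if k = j then 0 else c)"
        unfolding k by (intro sum.cong) (auto simp: two_blocks_def)
      then show ?thesis using row[OF \<open>k < m\<close>] False by simp
    qed
    finally show "(?H *\<^sub>v y) $ i = vec (2 * m) (\<lambda>i. if i < m then real m else c * (real m - 1)) $ i"
      using i by simp
  qed (simp add: H)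
  have xHx: "x \<bullet> (?H *\<^sub>v x) = real m * (c * (real m - 1))"
    and yHy: "y \<bullet> (?H *\<^sub>v y) = real m * (c * (real m - 1))"
    and xHy: "x \<bullet> (?H *\<^sub>v y) = real m * real m"
    unfolding Hx Hy by (simp_all add: scalar_prod_def atLeast0LessThan x_def y_def split)
  have less: "real m * real m < real m * (c * (real m - 1))"
    using m c by (intro mult_strict_left_mono) auto
  then have "x \<bullet> (?H *\<^sub>v x) > 0"
    unfolding xHx by (rule le_less_trans[rotated]) simp
  then have "(real m * (c * (real m - 1))) * (real m * (c * (real m - 1))) \<le> (real m * real m)\<^sup>2"
    using lorentzian_reverse_Cauchy_Schwarz[OF lor _ xy] m unfolding xHx yHy xHy by simp
  then have "(real m * (c * (real m - 1)))\<^sup>2 \<le> (real m * real m)\<^sup>2"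
    unfolding power2_eq_square[of "real m * (c * (real m - 1))"] .
  then have "real m * (c * (real m - 1)) \<le> real m * real m"
    by (rule power2_le_imp_le) simp
  with less show False by linarith
qed

theorem corollary6p2:
  "\<not> (\<exists>q::real. q > 0 \<and>
        (\<forall>n::nat. n \<ge> 2 \<longrightarrow>
           (\<forall>\<rho> :: nat \<Rightarrow> nat \<Rightarrow> real.
              weak_Tq_representation q n \<rho> \<longrightarrow> lorentzian_representation n \<rho>)))"
proof
  assume "\<exists>q::real. q > 0 \<and>
        (\<forall>n::nat. n \<ge> 2 \<longrightarrow>
           (\<forall>\<rho> :: nat \<Rightarrow> nat \<Rightarrow> real.
              weak_Tq_representation q n \<rho> \<longrightarrow> lorentzian_representation n \<rho>))"
  then obtain q :: real where q: "q > 0"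
    and all: "\<And>n \<rho>. n \<ge> 2 \<Longrightarrow> weak_Tq_representation q n \<rho> \<Longrightarrow> lorentzian_representation n \<rho>"
    by blast
  define c where "c = 2 powr (q / 2)"
  have c: "c > 1" using q by (simp add: c_def)
  obtain m :: nat where "real m > max 2 (c / (c - 1))"
    using reals_Archimedean2 by blast
  then have m: "real m > 2" "real m > c / (c - 1)" by auto
  then have "c * (real m - 1) > real m" using c by (simp add: field_simps)
  moreover have "weak_Tq_representation q (2 * m) (two_blocks m c)"
    by (rule weak_Tq_representation_if_bounded[OF q]) (use c in \<open>auto simp: two_blocks_def c_def\<close>)
  ultimately show False
    using two_blocks_not_lorentzian[of m c] all[of "2 * m" "two_blocks m c"] m by simp
qed

end
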